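(* Let $a,b,c$ be integers with $a\ge 1$, $b\ge 2$ and $c>0$, and let $n$ be a positive integer such that $ab^n-c>0$. Put $A_{3,n}=(ab^n-c,\ ab^{n+1}-c,\ ab^{n+2}-c)$ and suppose $\gcd(A_{3,n})=1$. Let $q=\left\lfloor \frac{ab^n-c}{b+1}\right\rfloor$ and $r=(ab^n-c)-(b+1)q$, so $0\le r\le b$. Then for every integer $p$ with $0\le p\le q$: \begin{itemize} \item if $(b+1)\nmid (ab^n-c)$, then $g_p(A_{3,n})=(r-1)(ab^{n+1}-c)+(q+p)(ab^{n+2}-c)-(ab^n-c)$; \item if $(b+1)\mid (ab^n-c)$, then $g_p(A_{3,n})=b(ab^{n+1}-c)+(q+p-1)(ab^{n+2}-c)-(ab^n-c)$. \end{itemize}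
   Context: For positive integers $a_1,\dots,a_k$ with $\gcd(a_1,\dots,a_k)=1$ and a nonnegative integer $p$, the $p$-Frobenius number $g_p(a_1,\dots,a_k)$ is the largest integer $m$ such that the number of tuples $(x_1,\dots,x_k)$ of nonnegative integers with $m=a_1x_1+\dots+a_kx_k$ is at most $p$. (For $p=0$ this is the classical Frobenius number.) *)

theory Defs
  imports Main
begin

text \<open>
  A tuple \<open>(x\<^sub>1, \<dots>, x\<^sub>k)\<close> of nonnegative integers is a \<open>nat list\<close> of the same length as the list
  of generators. The set of representations is finite whenever all generators are positive; only
  then is \<open>num_reps\<close> meaningful, as \<open>card\<close> of an infinite set is 0.
\<close>

definition num_reps :: "int list \<Rightarrow> int \<Rightarrow> nat" where
  "num_reps as m =
     card {xs :: nat list. length xs = length as \<and> m = (\<Sum>i<length as. as ! i * int (xs ! i))}"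

text \<open>
  The maximum ranges over all integers, so the value may be negative: it is \<open>-1\<close> for \<open>p = 0\<close>
  if 1 is among the generators. It exists if the generators are positive with greatest
  common divisor 1.
\<close>

definition p_frobenius :: "nat \<Rightarrow> int list \<Rightarrow> int" where
  "p_frobenius p as = (GREATEST m. num_reps as m \<le> p)"

end

theory Submission
  imports Defs
begin

text \<open>
  Put \<open>N = ab\<^sup>n - c\<close> and \<open>d = (b - 1)c\<close>. The generators are \<open>N\<close>, \<open>bN + d\<close> and
  \<open>b\<^sup>2N + (b + 1)d\<close>, with \<open>N\<close> and \<open>d\<close> coprime. With \<open>t = y + (b + 1)z\<close>, the contribution of
  \<open>y\<close> copies of the second and \<open>z\<close> copies of the third generator is \<open>t(bN + d) - bNz\<close>, which is
  congruent to \<open>td\<close> modulo \<open>N\<close>. So the residue of \<open>m\<close> fixes \<open>t\<close> modulo \<open>N\<close>, and the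
  representations of \<open>m\<close> are the admissible pairs \<open>(t, z)\<close> of this residue whose contribution
  is at most \<open>m\<close>. The least contribution for a given \<open>t\<close> strictly increases with \<open>t\<close>. The extremal
  residue is \<open>t = (b + 1)p - 1\<close>: it admits only \<open>p\<close> values of \<open>z\<close>, so the next contribution is the
  least one at \<open>t = N - 1 + (b + 1)p\<close>, and the \<open>p\<close>-Frobenius number is \<open>N\<close> less than that.
\<close>

locale frobenius_triple =
  fixes N b d :: int
  assumes N_pos: "N > 0" and b_pos: "b > 0" and d_pos: "d > 0" and coprime_N_d: "coprime N d"
begin

section \<open>Representations as pairs \<open>(t, z)\<close>\<close>

definition weight :: "int \<Rightarrow> int \<Rightarrow> int" where
  "weight t z = t * (b * N + d) - b * N * z"

text \<open>For fixed \<open>t\<close> the contribution falls as \<open>z\<close> grows, and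
  \<open>t div (b + 1)\<close> is the largest \<open>z\<close> that keeps
  \<open>y = t - (b + 1) * z\<close> nonnegative.\<close>

definition min_weight :: "int \<Rightarrow> int" where
  "min_weight t = weight t (t div (b + 1))"

definition reps :: "int \<Rightarrow> (int \<times> int) set" where
  "reps m = {(t, z). 0 \<le> z \<and> (b + 1) * z \<le> t \<and> weight t z \<le> m \<and> N dvd m - weight t z}"

abbreviation gens :: "int list" where
  "gens \<equiv> [N, b * N + d, b\<^sup>2 * N + (b + 1) * d]"

lemma weight_eq:
  "weight t z = (t - (b + 1) * z) * (b * N + d) + z * (b\<^sup>2 * N + (b + 1) * d)"
  by (simp add: weight_def algebra_simps power2_eq_square)

text \<open>The pair \<open>(t, z)\<close> determines \<open>y\<close>, and the number of copies of
  \<open>N\<close> is then forced to be the quotient \<open>(m - weight t z) div N\<close>.\<close>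

lemma num_reps_gens: "num_reps gens m = card (reps m)"
proof -
  let ?L = "{xs :: nat list. length xs = length gens \<and> m = (\<Sum>i<length gens. gens ! i * int (xs ! i))}"
  let ?f = "\<lambda>xs :: nat list. (int (xs ! 1) + (b + 1) * int (xs ! 2), int (xs ! 2))"
  let ?g = "\<lambda>(t, z). [nat ((m - weight t z) div N), nat (t - (b + 1) * z), nat z]"
  have L: "?L = {xs. \<exists>x y z. xs = [x, y, z] \<and>
      m - weight (int y + (b + 1) * int z) (int z) = N * int x}"
    by (auto simp: weight_eq numeral_3_eq_3 length_Suc_conv algebra_simps)
  have "bij_betw ?f ?L (reps m)"
  proof (rule bij_betw_byWitness[where f' = ?g])
    show "\<forall>xs\<in>?L. ?g (?f xs) = xs"
      unfolding L using N_pos by auto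
    show "\<forall>u\<in>reps m. ?f (?g u) = u"
      by (auto simp: reps_def)
    show "?f ` ?L \<subseteq> reps m"
    proof (rule image_subsetI)
      fix xs assume "xs \<in> ?L"
      then obtain x y z where xs: "xs = [x, y, z]"
        and eq: "m - weight (int y + (b + 1) * int z) (int z) = N * int x"
        unfolding L by blast
      have "0 \<le> N * int x" using N_pos by simp
      then have "weight (int y + (b + 1) * int z) (int z) \<le> m"
        unfolding eq[symmetric] by simp
      then show "?f xs \<in> reps m"
        by (simp add: xs reps_def eq)
    qed
    show "?g ` reps m \<subseteq> ?L"
      unfolding L using N_pos by (auto simp: reps_def pos_imp_zdiv_nonneg_iff)
  qed
  then show ?thesis
    unfolding num_reps_def by (rule bij_betw_same_card)
qed

section \<open>Growth of the least contribution\<close>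

lemma min_weight_le:
  assumes "(b + 1) * z \<le> t"
  shows "min_weight t \<le> weight t z"
proof -
  have "z \<le> t div (b + 1)"
    using zdiv_mono1[OF assms, of "b + 1"] b_pos by simp
  then show ?thesis
    using N_pos b_pos by (simp add: min_weight_def weight_def)
qed

lemma min_weight_strict_mono:
  assumes "s < t"
  shows "min_weight s < min_weight t"
proof -
  \<comment> \<open>Raising the argument by \<open>t - s\<close> raises the quotient by at most
    \<open>t - s\<close>, so the \<open>b * N\<close> terms cannot decrease the weight and a surplus
    \<open>d * (t - s)\<close> remains.\<close>
  have "t \<le> s + (t - s) * (b + 1)"
    using assms b_pos by (simp add: distrib_left)
  then have "t div (b + 1) \<le> (s + (t - s) * (b + 1)) div (b + 1)"
    using b_pos by (intro zdiv_mono1) auto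
  then have "t div (b + 1) - s div (b + 1) \<le> t - s"
    using b_pos by simp
  then have "b * N * (t div (b + 1) - s div (b + 1)) \<le> b * N * (t - s)"
    using N_pos b_pos by (intro mult_left_mono) auto
  moreover have "d * (t - s) > 0"
    using assms d_pos by simp
  ultimately show ?thesis
    by (simp add: min_weight_def weight_def algebra_simps)
qed

lemma min_weight_mono: "s \<le> t \<Longrightarrow> min_weight s \<le> min_weight t"
  using min_weight_strict_mono[of s t] by (cases "s = t") auto

lemma min_weight_shift:
  "min_weight (t + (b + 1) * k) = min_weight t + k * (b\<^sup>2 * N + (b + 1) * d)"
proof -
  have "(t + (b + 1) * k) div (b + 1) = t div (b + 1) + k"
    using b_pos by simp
  then show ?thesis
    unfolding min_weight_def weight_def by (simp add: algebra_simps power2_eq_square)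
qed

lemma weight_below_max: "weight t (t div (b + 1) - i) = min_weight t + b * N * i"
  by (simp add: min_weight_def weight_def algebra_simps)

text \<open>Since \<open>z\<close> is at most \<open>t\<close>, the \<open>b * N\<close> terms are
  jointly nonnegative, so the contribution is at least \<open>t * d\<close>, hence at least
  \<open>t\<close>.\<close>

lemma finite_reps: "finite (reps m)"
proof (rule finite_subset)
  show "reps m \<subseteq> {0..m} \<times> {0..m}"
  proof safe
    fix t z assume "(t, z) \<in> reps m"
    then have z: "0 \<le> z" "(b + 1) * z \<le> t" "weight t z \<le> m"
      by (auto simp: reps_def)
    have "z \<le> (b + 1) * z"
      using z(1) b_pos by (simp add: distrib_right)
    with z have zt: "z \<le> t" by simp
    then have "b * N * z \<le> b * N * t"
      using N_pos b_pos by (intro mult_left_mono) auto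
    moreover have "t * 1 \<le> t * d"
      using d_pos zt z(1) by (intro mult_left_mono) auto
    ultimately have "t \<le> weight t z"
      by (simp add: weight_def algebra_simps)
    with z zt show "t \<in> {0..m}" "z \<in> {0..m}" by auto
  qed
qed auto

section \<open>Residues modulo \<open>N\<close>\<close>

lemma dvd_diff_weight_iff: "N dvd m - weight t z \<longleftrightarrow> N dvd m - t * d"
proof -
  have "m - weight t z = (m - t * d) - N * (b * t - b * z)"
    by (simp add: weight_def algebra_simps)
  then show ?thesis
    by (metis dvd_triv_left dvd_add_left_iff diff_add_cancel)
qed

lemma obtain_residue:
  obtains t where "l \<le> t" "t < l + N" "N dvd m - t * d"
proof -
  obtain e f where "e * d + f * N = 1"
    using bezout_int[of d N] coprime_N_d by (metis coprime_commute coprime_iff_gcd_eq_1)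
  then have "e * d - 1 = N * (- f)"
    by (simp add: algebra_simps)
  then have e: "N dvd e * d - 1" ..
  \<comment> \<open>As \<open>e\<close> inverts \<open>d\<close> modulo \<open>N\<close>, the
    residue sought is that of \<open>e * m\<close>, moved into the window starting at
    \<open>l\<close>.\<close>
  define t where "t = l + (e * m - l) mod N"
  have "N dvd e * m - t"
    by (simp add: t_def mod_eq_dvd_iff[symmetric] mod_simps)
  then have "N dvd (e * m - t) * d - (e * d - 1) * m"
    using e by (metis dvd_diff dvd_mult2)
  moreover have "(e * m - t) * d - (e * d - 1) * m = m - t * d"
    by (simp add: algebra_simps)
  ultimately show ?thesis
    using that[of t] N_pos by (simp add: t_def)
qed

lemma residue_unique:
  assumes "N dvd m - s * d" "N dvd m - t * d"
  shows "N dvd s - t"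
proof -
  have "N dvd (s - t) * d"
    using dvd_diff[OF assms(2,1)] by (simp add: algebra_simps)
  then show ?thesis
    using coprime_N_d by (simp add: coprime_dvd_mult_left_iff)
qed

text \<open>If \<open>w\<close> exceeded \<open>m\<close>, it would do so by at least
  \<open>N\<close>, and hence exceed \<open>g\<close>.\<close>

lemma le_of_dvd_diff:
  assumes "N dvd m - w" "w \<le> g" "g - N < m"
  shows "w \<le> m"
proof (rule ccontr)
  assume "\<not> w \<le> m"
  then have "N \<le> w - m"
    using assms(1) by (intro zdvd_imp_le) (auto simp: dvd_diff_commute)
  with assms show False by simp
qed

section \<open>The extremal value and its two bounds\<close>

context
  fixes p :: nat and T :: int
  assumes p_le: "(b + 1) * int p \<le> N"
  defines "T \<equiv> N - 1 + (b + 1) * int p"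
begin

text \<open>A represented pair has \<open>t\<close> congruent to \<open>T\<close>, and
  \<open>t < T\<close> by monotonicity. Since \<open>T < 2 * N\<close>, only
  \<open>t = T - N = (b + 1) * p - 1\<close> remains, which leaves room for \<open>z < p\<close>
  only.\<close>

lemma card_reps_extremal_le: "card (reps (min_weight T - N)) \<le> p"
proof -
  have "reps (min_weight T - N) \<subseteq> {T - N} \<times> {0..<int p}"
  proof safe
    fix t z assume "(t, z) \<in> reps (min_weight T - N)"
    then have z: "0 \<le> z" "(b + 1) * z \<le> t" "weight t z \<le> min_weight T - N"
      and dvd: "N dvd (min_weight T - N) - weight t z"
      by (auto simp: reps_def)
    have "t < T"
      using min_weight_le[OF z(2)] min_weight_mono[of T t] z(3) N_pos by linarith
    have "N dvd (min_weight T - N) - T * d"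
      using dvd_diff_weight_iff[of "min_weight T - N" T "T div (b + 1)"]
      by (simp add: min_weight_def)
    then have "N dvd T - t"
      using residue_unique dvd[unfolded dvd_diff_weight_iff] by blast
    then obtain k where k: "T - t = N * k" by (elim dvdE)
    with \<open>t < T\<close> have "0 < N * k" by linarith
    with N_pos have "k > 0" by (simp add: zero_less_mult_iff)
    have "0 \<le> (b + 1) * z" using z(1) b_pos by simp
    with z(2) have "t \<ge> 0" by simp
    have "k = 1"
    proof (rule ccontr)
      assume "k \<noteq> 1"
      with \<open>k > 0\<close> have "N * 2 \<le> N * k" using N_pos by simp
      with k \<open>t \<ge> 0\<close> p_le show False unfolding T_def by linarith
    qed
    with k show "t = T - N" by simp
    with z(2) have "(b + 1) * z < (b + 1) * int p"
      unfolding T_def by linarith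
    with z(1) show "z \<in> {0..<int p}"
      using b_pos by simp
  qed
  then have "card (reps (min_weight T - N)) \<le> card ({T - N} \<times> {0..<int p})"
    by (intro card_mono) auto
  then show ?thesis by (simp add: card_cartesian_product)
qed

lemma card_reps_gt:
  assumes "min_weight T - N < m"
  shows "p < card (reps m)"
proof -
  let ?A = "b\<^sup>2 * N + (b + 1) * d"
  have minT: "min_weight T = min_weight (N - 1) + int p * ?A"
    by (simp add: T_def min_weight_shift)
  have "b * N * 1 \<le> b * N * b"
    using N_pos b_pos by (intro mult_left_mono) auto
  \<comment> \<open>Lowering \<open>z\<close> by one costs \<open>b * N\<close>; the budget
    \<open>min_weight T\<close> holds \<open>p\<close> units of \<open>?A\<close>, each of which
    pays for one such step.\<close>
  then have bN: "b * N \<le> ?A"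
    using mult_pos_pos[OF b_pos d_pos] d_pos by (simp add: power2_eq_square algebra_simps)
  \<comment> \<open>The window starts at \<open>(b + 1) * p\<close> so that at least
    \<open>p + 1\<close> values of \<open>z\<close> are admissible for \<open>t\<close>.\<close>
  obtain t where t: "(b + 1) * int p \<le> t" "t < (b + 1) * int p + N" "N dvd m - t * d"
    by (rule obtain_residue)
  have p_le_div: "int p \<le> t div (b + 1)"
    using zdiv_mono1[OF t(1), of "b + 1"] b_pos by simp
  have rep_max: "(t, t div (b + 1) - i) \<in> reps m"
    if "0 \<le> i" "i \<le> int p" "min_weight t + b * N * i \<le> min_weight T" for i
  proof -
    have "(b + 1) * (t div (b + 1) - i) \<le> (b + 1) * (t div (b + 1))"
      using that(1) b_pos by (intro mult_left_mono) auto
    also have "\<dots> \<le> t"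
      using pos_mod_sign[of "b + 1" t] b_pos mult_div_mod_eq[of "b + 1" t] by linarith
    finally have "(b + 1) * (t div (b + 1) - i) \<le> t" .
    moreover have "weight t (t div (b + 1) - i) \<le> m"
      using le_of_dvd_diff[OF _ _ assms] that(3) t(3)
      by (metis dvd_diff_weight_iff weight_below_max)
    ultimately show ?thesis
      using that(2) p_le_div t(3) by (simp add: reps_def dvd_diff_weight_iff)
  qed
  show ?thesis
  proof (cases "t < N")
    case True
    let ?S = "(\<lambda>i. (t, t div (b + 1) - i)) ` {0..int p}"
    have "?S \<subseteq> reps m"
    proof (intro image_subsetI rep_max)
      fix i assume i: "i \<in> {0..int p}"
      have "min_weight t \<le> min_weight (N - 1)"
        using True by (intro min_weight_mono) simp
      moreover have "b * N * i \<le> int p * ?A"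
        using i bN N_pos b_pos by (subst mult.commute, intro mult_mono) auto
      ultimately show "min_weight t + b * N * i \<le> min_weight T"
        by (simp add: minT)
    qed auto
    then have "card ?S \<le> card (reps m)"
      using finite_reps by (rule card_mono[rotated])
    moreover have "card ?S = p + 1"
      by (subst card_image) (auto simp: inj_on_def)
    ultimately show ?thesis by simp
  \<comment> \<open>Here \<open>t - N\<close> is also admissible. It supplies \<open>j + 1\<close>
    pairs, and the \<open>p - j\<close> cheapest pairs at \<open>t\<close> complete the count to
    \<open>p + 1\<close>.\<close>
  next
    case False
    define s where "s = t - N"
    define j where "j = s div (b + 1)"
    define e where "e = s mod (b + 1)"
    have s_eq: "s = (b + 1) * j + e" and e: "0 \<le> e" "e \<le> b"
      using b_pos pos_mod_bound[of "b + 1" s] by (auto simp: j_def e_def)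
    have s: "0 \<le> s" "s < (b + 1) * int p"
      using False t(2) by (auto simp: s_def)
    have "0 \<le> j"
      using s(1) b_pos by (simp add: j_def pos_imp_zdiv_nonneg_iff)
    have "(b + 1) * j < (b + 1) * int p"
      using s(2) s_eq e by linarith
    then have "j < int p"
      using b_pos by simp
    let ?S1 = "{s} \<times> {0..j}"
    let ?S2 = "(\<lambda>i. (t, t div (b + 1) - i)) ` {0..int p - 1 - j}"
    have "?S1 \<subseteq> reps m"
    proof safe
      fix z assume z: "z \<in> {0..j}"
      \<comment> \<open>Even the costliest choice \<open>z = 0\<close> fits:
        \<open>min_weight T\<close> exceeds the bound at \<open>(b + 1) * p - 1\<close> by
        \<open>N * (b * N + d) - b * N * (p + ?K)\<close>, which is nonnegative once
        \<open>p + ?K \<le> N\<close>.\<close>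
      have "weight s z \<le> s * (b * N + d)"
        using z N_pos b_pos by (simp add: weight_def)
      also have "\<dots> \<le> ((b + 1) * int p - 1) * (b * N + d)"
        using s(2) N_pos b_pos d_pos by (intro mult_right_mono) auto
      also have "\<dots> \<le> min_weight T"
      proof -
        let ?K = "(N - 1) div (b + 1)"
        have "(b + 1) * ?K \<le> N - 1"
          using pos_mod_sign[of "b + 1" "N - 1"] b_pos mult_div_mod_eq[of "b + 1" "N - 1"]
          by linarith
        then have "(b + 1) * (int p + ?K) \<le> 2 * N"
          using p_le by (simp add: distrib_left)
        also have "\<dots> \<le> (b + 1) * N"
          using N_pos b_pos by (intro mult_right_mono) auto
        finally have "int p + ?K \<le> N"
          using b_pos by (simp del: distrib_right_numeral)
        then have "b * N * (int p + ?K) \<le> b * N * N"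
          using N_pos b_pos by (intro mult_left_mono) auto
        also have "\<dots> \<le> N * (b * N + d)"
          using N_pos d_pos by (simp add: algebra_simps)
        finally show ?thesis
          unfolding minT unfolding min_weight_def weight_def
          by (simp add: algebra_simps power2_eq_square)
      qed
      finally have "weight s z \<le> min_weight T" .
      moreover have "N dvd m - weight s z"
      proof -
        have "m - s * d = (m - t * d) + N * d"
          by (simp add: s_def algebra_simps)
        then show ?thesis
          using t(3) by (simp only: dvd_diff_weight_iff dvd_add dvd_triv_left)
      qed
      moreover have "(b + 1) * z \<le> s"
      proof -
        have "(b + 1) * z \<le> (b + 1) * j"
          using z b_pos by (intro mult_left_mono) auto
        then show ?thesis
          using s_eq e(1) by linarith
      qed
      ultimately show "(s, z) \<in> reps m"
        using z le_of_dvd_diff assms by (auto simp: reps_def)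
    qed
    moreover have "?S2 \<subseteq> reps m"
    proof (intro image_subsetI rep_max)
      fix i assume i: "i \<in> {0..int p - 1 - j}"
      then show "0 \<le> i" "i \<le> int p" using \<open>0 \<le> j\<close> by simp_all
      \<comment> \<open>Rounding \<open>e\<close> up to \<open>b\<close> uses one further
        \<open>?A\<close>, so \<open>j + 1\<close> of the \<open>p\<close> units are spent and
        \<open>p - 1 - j\<close> are left for lowering \<open>z\<close>.\<close>
      have "min_weight t = min_weight (N + e) + j * ?A"
        using min_weight_shift[of "N + e" j] s_eq by (simp add: s_def algebra_simps)
      also have "min_weight (N + e) \<le> min_weight (N - 1 + (b + 1) * 1)"
        using e by (intro min_weight_mono) simp
      also have "\<dots> = min_weight (N - 1) + ?A"
        by (simp only: min_weight_shift mult_1)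
      finally have "min_weight t \<le> min_weight (N - 1) + (j + 1) * ?A"
        by (simp add: algebra_simps)
      moreover have "b * N * i \<le> (int p - 1 - j) * ?A"
        using i bN N_pos b_pos by (subst mult.commute, intro mult_mono) auto
      ultimately show "min_weight t + b * N * i \<le> min_weight T"
        by (simp add: minT algebra_simps)
    qed
    ultimately have "card (?S1 \<union> ?S2) \<le> card (reps m)"
      using finite_reps by (intro card_mono) auto
    moreover have "card (?S1 \<union> ?S2) = card ?S1 + card ?S2"
      using N_pos by (intro card_Un_disjoint) (auto simp: s_def)
    moreover have "card ?S2 = nat (int p - j)"
      by (subst card_image) (auto simp: inj_on_def)
    moreover have "card ?S1 = nat (j + 1)"
      by (simp add: card_cartesian_product)
    ultimately show ?thesis
      using \<open>0 \<le> j\<close> \<open>j < int p\<close> by linarith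
  qed
qed

lemma p_frobenius_gens: "p_frobenius p gens = min_weight T - N"
  unfolding p_frobenius_def num_reps_gens
proof (rule Greatest_equality)
  show "card (reps (min_weight T - N)) \<le> p"
    by (rule card_reps_extremal_le)
  show "m \<le> min_weight T - N" if "card (reps m) \<le> p" for m
    using that card_reps_gt[of m] by linarith
qed

end

end

section \<open>The original generators and the two divisibility cases\<close>

theorem theorem1:
  fixes a b c q r :: int and n :: nat and A :: "int list"
  assumes "a \<ge> 1" and "b \<ge> 2" and "c > 0" and "n > 0"
    and "a * b ^ n - c > 0"
    and "A = [a * b ^ n - c, a * b ^ (n + 1) - c, a * b ^ (n + 2) - c]"
    and "Gcd (set A) = 1"
    and "q = (a * b ^ n - c) div (b + 1)"
    and "r = (a * b ^ n - c) - (b + 1) * q"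
  shows "0 \<le> r \<and> r \<le> b \<and>
    (\<forall>p :: nat. int p \<le> q \<longrightarrow>
      (\<not> (b + 1) dvd (a * b ^ n - c) \<longrightarrow>
        p_frobenius p A =
          (r - 1) * (a * b ^ (n + 1) - c) + (q + int p) * (a * b ^ (n + 2) - c) - (a * b ^ n - c)) \<and>
      ((b + 1) dvd (a * b ^ n - c) \<longrightarrow>
        p_frobenius p A =
          b * (a * b ^ (n + 1) - c) + (q + int p - 1) * (a * b ^ (n + 2) - c) - (a * b ^ n - c)))"
proof -
  define N where "N = a * b ^ n - c"
  define d where "d = (b - 1) * c"
  have A2: "a * b ^ (n + 1) - c = b * N + d"
    and A3: "a * b ^ (n + 2) - c = b\<^sup>2 * N + (b + 1) * d"
    by (simp_all add: N_def d_def algebra_simps power2_eq_square)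
  have A: "A = [N, b * N + d, b\<^sup>2 * N + (b + 1) * d]"
    using assms(6) A2 A3 by (simp add: N_def)
  \<comment> \<open>Each generator is an integer combination of \<open>N\<close> and
    \<open>d\<close>.\<close>
  have "gcd N d dvd Gcd (set A)"
    by (rule Gcd_greatest) (auto simp: A)
  then have "coprime N d"
    using assms(7) by (simp add: coprime_iff_gcd_eq_1)
  then interpret frobenius_triple N b d
    using assms by unfold_locales (auto simp: N_def d_def)
  have q: "q = N div (b + 1)" and r: "r = N mod (b + 1)"
    using assms(8,9) by (simp_all add: N_def minus_mult_div_eq_mod)
  have N_eq: "N = (b + 1) * q + r"
    by (simp add: q r)
  have r_bounds: "0 \<le> r" "r \<le> b"
    using b_pos pos_mod_bound[of "b + 1" N] by (auto simp: r)
  have frob: "p_frobenius p A = min_weight (N - 1) + int p * (b\<^sup>2 * N + (b + 1) * d) - N"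
    if "int p \<le> q" for p
  proof -
    have "(b + 1) * int p \<le> (b + 1) * q"
      using that b_pos by (intro mult_left_mono) auto
    then have "(b + 1) * int p \<le> N"
      using N_eq r_bounds by linarith
    then show ?thesis
      using p_frobenius_gens[of p] by (simp add: A min_weight_shift)
  qed
  \<comment> \<open>Division of \<open>N - 1\<close> by \<open>b + 1\<close> yields the
    coefficients: remainder \<open>r - 1\<close> and quotient \<open>q\<close> if \<open>r\<close>
    is nonzero, otherwise a borrow gives \<open>b\<close> and \<open>q - 1\<close>.\<close>
  have min_weight_eq: "min_weight (N - 1) = y * (b * N + d) + z * (b\<^sup>2 * N + (b + 1) * d)"
    if "N - 1 = y + (b + 1) * z" "0 \<le> y" "y \<le> b" for y z
  proof -
    have "(N - 1) div (b + 1) = z"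
      using that b_pos by simp
    then show ?thesis
      using that(1) weight_eq[of "N - 1" z] by (simp add: min_weight_def)
  qed
  have nondvd: "min_weight (N - 1) = (r - 1) * (b * N + d) + q * (b\<^sup>2 * N + (b + 1) * d)"
    if "\<not> (b + 1) dvd N"
  proof (rule min_weight_eq)
    have "r \<noteq> 0"
      using that r by (simp add: dvd_eq_mod_eq_0)
    with r_bounds show "0 \<le> r - 1" "r - 1 \<le> b" by linarith+
    show "N - 1 = r - 1 + (b + 1) * q"
      using N_eq by linarith
  qed
  have dvd: "min_weight (N - 1) = b * (b * N + d) + (q - 1) * (b\<^sup>2 * N + (b + 1) * d)"
    if "(b + 1) dvd N"
  proof (rule min_weight_eq)
    have "r = 0"
      using that r by (simp add: dvd_eq_mod_eq_0)
    then show "N - 1 = b + (b + 1) * (q - 1)"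
      using N_eq by (simp add: right_diff_distrib)
  qed (use b_pos in auto)
  show ?thesis
    unfolding A2 A3 N_def[symmetric]
  proof (intro conjI allI impI)
    fix p :: nat
    assume p: "int p \<le> q"
    {
      assume "\<not> (b + 1) dvd N"
      from frob[OF p] nondvd[OF this]
      show "p_frobenius p A =
          (r - 1) * (b * N + d) + (q + int p) * (b\<^sup>2 * N + (b + 1) * d) - N"
        by (simp add: distrib_right)
    next
      assume "(b + 1) dvd N"
      from frob[OF p] dvd[OF this]
      show "p_frobenius p A =
          b * (b * N + d) + (q + int p - 1) * (b\<^sup>2 * N + (b + 1) * d) - N"
        by (simp add: distrib_right left_diff_distrib)
    }
  qed (use r_bounds in auto)
qed

end
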